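(* Let $\alpha>0$. For $s=\sigma+it$ in the region defined by $t>0$ and $0<-\sigma<t^{\alpha}$, and $s\to\infty$, we have $$\mathcal{R}(s)=\chi(s)\,O(\log|t|),$$ where the implied constant may depend on $\alpha$.
   Context: Riemann's auxiliary function is the entire function $$\mathcal{R}(s)=\int_{0\swarrow1}\frac{x^{-s}e^{\pi i x^2}}{e^{\pi i x}-e^{-\pi i x}}\,dx,$$ where the path is a straight line of direction $e^{-3\pi i/4}$ (running from the upper right to the lower left) crossing the real axis at a point strictly between $0$ and $1$, and $x^{-s}=\exp(-s\log x)$ with the principal logarithm. $\chi(s)=\pi^{s-\frac12}\Gamma(\frac{1-s}{2})/\Gamma(\frac{s}{2})$, so that $\zeta(s)=\chi(s)\zeta(1-s)$. *)

theory Defs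
  imports "HOL-Analysis.Analysis" "HOL-Library.Landau_Symbols"
begin

definition aux_integrand :: "complex \<Rightarrow> complex \<Rightarrow> complex" where
  "aux_integrand s x =
     exp (- s * Ln x) * exp (complex_of_real pi * \<i> * x\<^sup>2)
       / (exp (complex_of_real pi * \<i> * x) - exp (- (complex_of_real pi * \<i> * x)))"

(* Library contour integrals are over compact paths only, so the integral over the whole
   line x(u) = c + u exp(-3 pi i/4), u running from -infinity to infinity (upper right to
   lower left), is written out as the integral of aux_integrand s (x u) * x'(u).  It
   converges absolutely because the modulus of exp (pi i x^2) decays like exp (- pi u^2).  By Cauchy's
   theorem the value is the same for all crossing points 0 < c < 1. *)
definition riemann_aux :: "real \<Rightarrow> complex \<Rightarrow> complex" where
  "riemann_aux c s =
     (LINT u|lborel.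
        aux_integrand s (complex_of_real c + complex_of_real u * cis (- (3 * pi / 4)))
          * cis (- (3 * pi / 4)))"

definition chi :: "complex \<Rightarrow> complex" where
  "chi s = complex_of_real pi powr (s - 1 / 2) * Gamma ((1 - s) / 2) / Gamma (s / 2)"

definition aux_region :: "real \<Rightarrow> complex set" where
  "aux_region \<alpha> = {s. Im s > 0 \<and> 0 < - Re s \<and> - Re s < Im s powr \<alpha>}"

end

theory Submission
  imports Defs "HOL-Complex_Analysis.Complex_Analysis" "HOL-Probability.Distributions"
    "HOL-Real_Asymp.Real_Asymp"
begin

text \<open>
  Write \<open>s = -m + it\<close> with \<open>m \<ge> 0\<close>. Both sides are compared with \<open>sqrt t * (m + t) powr (m/2)\<close>.

  Moving the line of integration to the crossing point \<open>N + 1/2\<close>, where \<open>N\<close> is the integer part of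
  \<open>sqrt (t / (2 \<pi>))\<close>, picks up \<open>n powr (-s)\<close> for \<open>1 \<le> n \<le> N\<close>; these terms are bounded trivially. The new
  crossing point is close enough to the saddle point that the integrand on the new line is at most
  \<open>(m + t) powr (m/2)\<close> times a Gaussian, uniformly in \<open>m\<close>.

  Conversely, \<open>|\<chi>(s)|\<close> equals \<open>|sin (\<pi> s / 2) \<Gamma>(1 + m - it)| / (\<pi> (2 \<pi>) powr m)\<close>. For \<open>m = 0\<close> the
  reflection formula evaluates the Gamma factor. The bound propagates to all \<open>m \<ge> 0\<close> because the
  logarithmic derivative \<open>Re \<psi>(1 + m - it) \<ge> ln |1 + m - it| - 2\<close> of the Gamma factor exceeds that of
  \<open>(4 \<pi>\<^sup>2 (m + t)) powr (m/2)\<close> once \<open>t\<close> is large.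
\<close>

section \<open>Lower bound for the factor chi\<close>

text \<open>\<open>Re (Digamma z)\<close> is the limit of \<open>ln M\<close> minus the sum of
  \<open>Re (1 / (z + n))\<close>. Each term is at most an increment of \<open>B\<close>, whose
  logarithm is the integral of the summand and whose \<open>- 2 / v\<close> absorbs the error of
  replacing sum by integral. The telescoped bound tends to \<open>B x\<close>.\<close>

lemma Re_Digamma_ge:
  fixes z :: complex
  assumes "Re z \<ge> 1"
  shows "Re (Digamma z) \<ge> ln (cmod z) - 2"
proof -
  define x y where "x = Re z" and "y = Im z"
  have x: "x \<ge> 1" using assms by (simp add: x_def)
  define B where "B v = ln (v\<^sup>2 + y\<^sup>2) / 2 - 2 / v" for v :: real
  have step: "v / (v\<^sup>2 + y\<^sup>2) \<le> B (v + 1) - B v" if v: "v \<ge> 1" for v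
  proof -
    define p q r where "p = v\<^sup>2 + y\<^sup>2" and "q = (v+1)\<^sup>2 + y\<^sup>2"
      and "r = (2 * v + 1) / ((v+1)\<^sup>2 + y\<^sup>2)"
    have pv: "p \<ge> v\<^sup>2" "q \<ge> (v+1)\<^sup>2" by (simp_all add: p_def q_def)
    have pos': "v\<^sup>2 > 0" "(v+1)\<^sup>2 > 0" using v by simp_all
    have pos: "p > 0" "q > 0" "v\<^sup>2 > 0" "(v+1)\<^sup>2 > 0"
      by (fact pos' less_le_trans[OF pos'(1) pv(1)] less_le_trans[OF pos'(2) pv(2)])+
    have qp: "q - p = 2 * v + 1" by (simp add: p_def q_def power2_eq_square algebra_simps)
    \<comment> \<open>The logarithm in \<open>B\<close> grows by at least \<open>r / 2\<close>. What
      remains is to bound \<open>v / p - r / 2\<close> by the telescoping difference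
      \<open>2 / v - 2 / (v + 1)\<close>.\<close>
    have "ln p - ln q \<le> p / q - 1" using pos ln_le_minus_one[of "p / q"] by (simp add: ln_div)
    also have "p / q - 1 = - (2 * v + 1) / q" using pos qp by (simp add: field_simps)
    also have "\<dots> = - r" unfolding r_def q_def by (rule minus_divide_left [symmetric])
    finally have 1: "(ln q - ln p) / 2 \<ge> r / 2" by simp
    have "v / p - (2 * v + 1) / (2 * q) = (2 * v * q - (2 * v + 1) * p) / (2 * p * q)"
      using pos by (simp add: field_simps)
    also have "2 * v * q - (2 * v + 1) * p = 2 * v * (2 * v + 1) - p"
      using qp by (simp add: algebra_simps)
    also have "(2 * v * (2 * v + 1) - p) / (2 * p * q) \<le> (4 * (v * (v + 1))) / (2 * p * q)"
      using pos v by (intro divide_right_mono) (auto simp: algebra_simps)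
    also have "\<dots> \<le> (4 * (v * (v + 1))) / (2 * v\<^sup>2 * (v + 1)\<^sup>2)"
    proof (rule divide_left_mono)
      have "v\<^sup>2 * (v + 1)\<^sup>2 \<le> p * q"
        by (rule mult_mono [OF pv less_imp_le [OF pos(1)] less_imp_le [OF pos(4)]])
      then show "2 * v\<^sup>2 * (v + 1)\<^sup>2 \<le> 2 * p * q" by simp
      show "0 < 2 * p * q * (2 * v\<^sup>2 * (v + 1)\<^sup>2)"
        using pos by simp
    qed (use v in simp)
    also have "\<dots> = 2 / v - 2 / (v + 1)"
      using v by (simp add: divide_simps power2_eq_square)
    finally have "v / p - r / 2 \<le> 2 / v - 2 / (v + 1)"
      by (simp add: r_def q_def mult.commute)
    then show ?thesis using 1 unfolding B_def p_def [symmetric] q_def [symmetric] by argo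
  qed
  have sum_le: "(\<Sum>n<M. (x + real n) / ((x + real n)\<^sup>2 + y\<^sup>2)) \<le> B (x + real M) - B x" for M
  proof (induction M)
    case (Suc M)
    show ?case using Suc step[of "x + real M"] x by (simp add: add_ac)
  qed simp
  have Re_inv: "Re (inverse (z + of_nat n)) = (x + real n) / ((x + real n)\<^sup>2 + y\<^sup>2)" for n
    by (simp add: x_def y_def)
  have "z \<noteq> 0" using x x_def by auto
  from tendsto_Re[OF Digamma_LIMSEQ[OF this]]
  have lim: "(\<lambda>M. ln (real M) - (\<Sum>n<M. (x + real n) / ((x + real n)\<^sup>2 + y\<^sup>2)))
              \<longlonglongrightarrow> Re (Digamma z)"
    by (simp only: minus_complex.sel Re_sum Re_inv Re_complex_of_real)
  \<comment> \<open>That is, \<open>ln M - B (x + M)\<close> vanishes in the limit, so only the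
    lower endpoint \<open>B x\<close> survives.\<close>
  have "(\<lambda>M. ln (real M) - ln ((x + real M)\<^sup>2 + y\<^sup>2) / 2 + 2 / (x + real M)) \<longlonglongrightarrow> 0"
    by real_asymp
  then have "(\<lambda>M. ln (real M) - (B (x + real M) - B x)) \<longlonglongrightarrow> B x"
    using tendsto_add[OF _ tendsto_const[of "B x"]] unfolding B_def by (fastforce simp: algebra_simps)
  from LIMSEQ_le[OF this lim] have "B x \<le> Re (Digamma z)"
    using sum_le by (meson diff_left_mono)
  moreover have "ln (cmod z) = ln (x\<^sup>2 + y\<^sup>2) / 2"
    using x by (simp add: cmod_def x_def y_def ln_sqrt)
  moreover have "2 / x \<le> 2" using x by (simp add: field_simps)
  ultimately show ?thesis unfolding B_def by linarith
qed

text \<open>\<open>E v\<close> is the logarithm of the quotient of the two growing factors, and the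
  claim is \<open>E 0 \<le> E m\<close>. The threshold \<open>exp 12\<close> makes \<open>E'\<close>
  nonnegative: this needs \<open>ln X / 2 \<ge> ln (4 * pi) + 5 / 2\<close>, and
  \<open>ln (4 * pi) \<le> 7 / 2\<close>.\<close>

lemma cmod_Gamma_ge:
  fixes m t y :: real
  assumes m: "m \<ge> 0" and t: "t \<ge> exp 12" and y: "\<bar>y\<bar> = t"
  shows "cmod (Gamma (Complex (1 + m) y)) \<ge>
           cmod (Gamma (Complex 1 y)) * (4 * pi\<^sup>2 * (m + t)) powr (m / 2)"
proof -
  have t0: "t > 0" using t by (meson exp_gt_zero less_le_trans)
  have ln4pi: "ln (4 * pi) \<le> 7 / 2"
  proof -
    have "ln (4 * pi) \<le> ln (2 ^ 4)" using pi_less_4 by (intro ln_mono) auto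
    also have "\<dots> = 4 * ln 2" by (subst ln_realpow) auto
    finally show ?thesis using ln2_le_25_over_36 by simp
  qed
  have cm: "Complex (1 + v) y = complex_of_real v + Complex 1 y" for v
    by (simp add: complex_eq_iff)
  have nonpos: "Complex (1 + v) y \<notin> \<real>\<^sub>\<le>\<^sub>0" for v
    using y t0 by (auto simp: complex_nonpos_Reals_iff)
  define E where "E v = Re (ln_Gamma (Complex (1 + v) y)) - v / 2 * ln (4 * pi\<^sup>2 * (v + t))" for v
  define E' where "E' v = Re (Digamma (Complex (1 + v) y)) -
      (ln (4 * pi\<^sup>2 * (v + t)) / 2 + v / 2 * (1 / (v + t)))" for v
  have deriv: "(E has_real_derivative E' v) (at v)" if v: "v \<ge> 0" for v
  proof -
    have "((\<lambda>w. ln_Gamma (w + Complex 1 y)) has_field_derivative Digamma (Complex (1 + v) y))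
        (at (complex_of_real v))"
      using nonpos[of v] by (auto intro!: derivative_eq_intros simp: cm)
    from has_field_derivative_Re[OF has_vector_derivative_real_field[OF this]]
    have "((\<lambda>w. Re (ln_Gamma (Complex (1 + w) y))) has_real_derivative
        Re (Digamma (Complex (1 + v) y))) (at v)"
      by (simp add: cm)
    moreover have "((\<lambda>w. w / 2 * ln (4 * pi\<^sup>2 * (w + t))) has_real_derivative
        (ln (4 * pi\<^sup>2 * (v + t)) / 2 + v / 2 * (1 / (v + t)))) (at v)"
      using v t0 by (auto intro!: derivative_eq_intros) (simp add: divide_simps)
    ultimately show ?thesis unfolding E_def E'_def by (rule DERIV_diff)
  qed
  have E'_nonneg: "E' v \<ge> 0" if v: "v \<ge> 0" for v
  proof -
    define X where "X = v + t"
    have X: "X \<ge> t" "X > 0" using v t0 by (auto simp: X_def)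
    have lnX: "ln X \<ge> 12" using t X by (subst ln_ge_iff) auto
    \<comment> \<open>The modulus is at least \<open>1 + v\<close> and at least \<open>t\<close>,
      hence at least their mean.\<close>
    have "X / 2 \<le> cmod (Complex (1 + v) y)"
      using complex_Re_le_cmod[of "Complex (1 + v) y"] abs_Im_le_cmod[of "Complex (1 + v) y"] y
      by (simp add: X_def)
    then have "ln (X / 2) \<le> ln (cmod (Complex (1 + v) y))"
      using X by (intro ln_mono) auto
    then have "Re (Digamma (Complex (1 + v) y)) \<ge> ln X - ln 2 - 2"
      using Re_Digamma_ge[of "Complex (1 + v) y"] v X by (simp add: ln_div)
    moreover have "ln (4 * pi\<^sup>2 * X) = ln X + 2 * ln (2 * pi)"
      using X ln_realpow[of "2 * pi" 2] by (simp add: ln_mult power_mult_distrib)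
    moreover have "ln (4 * pi) = ln 2 + ln (2 * pi)"
      using ln_mult[of 2 "2 * pi"] by simp
    moreover have "v / 2 * (1 / X) \<le> 1 / 2" using v X t0 by (simp add: X_def field_simps)
    ultimately show ?thesis using ln4pi lnX unfolding E'_def X_def[symmetric] by linarith
  qed
  have "E 0 \<le> E m"
    using DERIV_nonneg_imp_nondecreasing[of 0 m E] m deriv E'_nonneg by blast
  then have "exp (Re (ln_Gamma (Complex 1 y))) * exp (m / 2 * ln (4 * pi\<^sup>2 * (m + t)))
      \<le> exp (Re (ln_Gamma (Complex (1 + m) y)))"
    unfolding E_def by (simp flip: exp_add)
  moreover have G: "cmod (Gamma (Complex (1 + v) y)) = exp (Re (ln_Gamma (Complex (1 + v) y)))" for v
    using nonpos[of v] nonpos_Ints_subset_nonpos_Reals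
    by (auto simp: Gamma_complex_altdef)
  moreover have "(4 * pi\<^sup>2 * (m + t)) powr (m / 2) = exp (m / 2 * ln (4 * pi\<^sup>2 * (m + t)))"
    using m t0 by (simp add: powr_def)
  ultimately show ?thesis by (simp add: G[of m] G[of 0, simplified])
qed

text \<open>Expand the quotient by \<open>Gamma (1 - s / 2)\<close>: Legendre duplication evaluates
  the new numerator and the reflection formula the new denominator. This leaves a single Gamma
  factor, to which the growth estimate in \<open>m\<close> applies.\<close>

lemma Gamma_half_ratio:
  fixes s :: complex
  assumes "Im s \<noteq> 0"
  shows "Gamma ((1 - s) / 2) / Gamma (s / 2) =
           2 powr s * Gamma (1 - s) * sin (of_real pi * s / 2) / of_real (sqrt pi)"
proof -
  have nonpos: "z \<notin> \<int>\<^sub>\<le>\<^sub>0" if "Im z \<noteq> 0" for z :: complex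
    using that by (auto elim!: nonpos_Ints_cases)
  define z where "z = (1 - s) / 2"
  have z: "2 * z = 1 - s" "z + 1 / 2 = 1 - s / 2"
    by (simp_all add: z_def field_simps)
  have "Gamma z * Gamma (z + 1 / 2) =
      exp ((1 - 2 * z) * of_real (ln 2)) * of_real (sqrt pi) * Gamma (2 * z)"
    by (rule Gamma_legendre_duplication; rule nonpos) (use assms in \<open>auto simp: z_def\<close>)
  then have dup: "Gamma ((1 - s) / 2) * Gamma (1 - s / 2) =
      2 powr s * of_real (sqrt pi) * Gamma (1 - s)"
    unfolding z using Ln_of_real[of 2] by (simp add: powr_def z_def)
  have refl: "Gamma (s / 2) * Gamma (1 - s / 2) = of_real pi / sin (of_real pi * s / 2)"
    using Gamma_reflection_complex[of "s / 2"] by simp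
  have nz: "Gamma (s / 2) \<noteq> 0" "Gamma (1 - s / 2) \<noteq> 0"
    using assms by (auto simp: Gamma_eq_zero_iff intro!: nonpos)
  have "Gamma ((1 - s) / 2) / Gamma (s / 2) =
      (Gamma ((1 - s) / 2) * Gamma (1 - s / 2)) / (Gamma (s / 2) * Gamma (1 - s / 2))"
    using nz by simp
  also have "\<dots> = 2 powr s * of_real (sqrt pi) * Gamma (1 - s) *
      sin (of_real pi * s / 2) / (of_real (sqrt pi) * of_real (sqrt pi))"
    unfolding dup refl by (simp flip: of_real_mult)
  finally show ?thesis by simp
qed

text \<open>This follows from \<open>|sin z|^2 = sin^2 (Re z) + sinh^2 (Im z)\<close>.\<close>

lemma cmod_sin_ge: "cmod (sin z) \<ge> \<bar>sinh (Im z)\<bar>"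
proof -
  have "(cmod (sin z))\<^sup>2 - (sinh (Im z))\<^sup>2 = (1 - cos (2 * Re z)) / 2"
    unfolding norm_sin_squared sinh_field_def
    using exp_double[of "Im z"]
    by (simp add: exp_minus power2_diff power_divide field_simps power2_eq_square)
  moreover have "cos (2 * Re z) \<le> 1" by simp
  ultimately have "\<bar>sinh (Im z)\<bar>\<^sup>2 \<le> (cmod (sin z))\<^sup>2"
    unfolding power2_abs by argo
  then show ?thesis by (rule power2_le_imp_le) simp
qed

text \<open>The square of the modulus is \<open>Gamma (1 + iy) * Gamma (1 - iy)\<close>, which the
  functional equation and the reflection formula evaluate exactly.\<close>

lemma cmod_Gamma_Complex_1:
  assumes "y \<noteq> 0"
  shows "(cmod (Gamma (Complex 1 y)))\<^sup>2 = pi * y / sinh (pi * y)"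
proof -
  have cnj: "Complex 1 (-y) = cnj (Complex 1 y)" by (simp add: complex_eq_iff)
  have 1: "Complex 1 y = 1 + \<i> * of_real y" "Complex 1 (-y) = 1 - \<i> * of_real y"
    by (simp_all add: complex_eq_iff)
  have "complex_of_real ((cmod (Gamma (Complex 1 y)))\<^sup>2) =
      Gamma (Complex 1 y) * Gamma (Complex 1 (-y))"
    unfolding cnj cnj_Gamma [symmetric] by (rule complex_norm_square)
  also have "\<dots> = \<i> * of_real y * (Gamma (\<i> * of_real y) * Gamma (1 - \<i> * of_real y))"
  proof -
    have "\<i> * of_real y \<notin> \<int>\<^sub>\<le>\<^sub>0"
      using assms by (auto elim!: nonpos_Ints_cases simp: complex_eq_iff)
    then show ?thesis
      unfolding 1 using Gamma_plus1[of "\<i> * of_real y"] by (simp add: add.commute)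
  qed
  also have "\<dots> = \<i> * of_real y * (of_real pi / sin (\<i> * of_real (pi * y)))"
    unfolding Gamma_reflection_complex by (simp add: mult_ac)
  also have "sin (\<i> * of_real (pi * y)) = \<i> * of_real (sinh (pi * y))"
    by (simp add: sin_i_times sinh_field_def exp_minus exp_of_real del: of_real_mult)
  also have "\<i> * of_real y * (of_real pi / (\<i> * of_real (sinh (pi * y)))) =
      complex_of_real (pi * y / sinh (pi * y))"
    using assms by (simp add: field_simps)
  finally show ?thesis by (simp only: of_real_eq_iff)
qed

text \<open>The exponential growth of the sine cancels the exponential decay of Gamma. With
  \<open>x = pi * t / 2\<close> the squared product is at least \<open>x * tanh x\<close>, and
  \<open>tanh x \<ge> 2 / 3\<close> together with \<open>pi > 3\<close> turns this into
  \<open>t\<close>.\<close>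

lemma cmod_sin_mult_Gamma_ge:
  assumes "t \<ge> 4" "Im z = t / 2"
  shows "cmod (sin (of_real pi * z)) * cmod (Gamma (Complex 1 (-t))) \<ge> sqrt t"
proof -
  define x where "x = pi * t / 2"
  have x: "x \<ge> 4" using assms(1) pi_ge_two mult_mono[of 2 pi 4 t] by (simp add: x_def)
  have sinh: "sinh x > 0" using x by simp
  have "5 * exp (-x) \<le> 5 * 1" using x by (intro mult_left_mono) auto
  moreover have "5 \<le> exp x" using exp_ge_add_one_self[of x] x by linarith
  \<comment> \<open>Equivalent to \<open>5 * exp (-x) \<le> exp x\<close>.\<close>
  ultimately have 1: "2 * cosh x \<le> 3 * sinh x"
    unfolding sinh_field_def cosh_field_def by argo
  have pt: "pi * t = 2 * x" by (simp add: x_def)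
  have "(sinh x)\<^sup>2 * (pi * t / sinh (2 * x)) = x * (sinh x / cosh x)"
    using sinh unfolding sinh_double pt by (simp add: power2_eq_square)
  also have "\<dots> \<ge> x * (2 / 3)"
    using 1 x by (intro mult_left_mono) (auto simp: field_simps cosh_real_pos)
  also have "x * (2 / 3) \<ge> t"
    using pi_ge_two pi_gt3 assms(1) by (simp add: x_def field_simps)
  finally have "t \<le> (sinh x)\<^sup>2 * (pi * t / sinh (2 * x))" .
  also have "pi * t / sinh (2 * x) = (cmod (Gamma (Complex 1 (-t))))\<^sup>2"
    using cmod_Gamma_Complex_1[of "-t"] assms(1) by (simp add: x_def)
  also have "(sinh x)\<^sup>2 * (cmod (Gamma (Complex 1 (-t))))\<^sup>2 \<le>
      (cmod (sin (of_real pi * z)))\<^sup>2 * (cmod (Gamma (Complex 1 (-t))))\<^sup>2"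
    using cmod_sin_ge[of "of_real pi * z"] sinh assms(2)
    by (intro mult_right_mono power_mono) (auto simp: x_def)
  finally show ?thesis by (intro real_le_lsqrt) (auto simp: power_mult_distrib)
qed

lemma cmod_chi_ge:
  assumes m: "m \<ge> 0" and t: "t \<ge> exp 12"
  shows "cmod (chi (Complex (-m) t)) \<ge> sqrt t * (m + t) powr (m / 2) / pi"
proof -
  define s where "s = Complex (-m) t"
  have t4: "t \<ge> 4" using t exp_ge_add_one_self[of 12] by linarith
  \<comment> \<open>The factor \<open>(2 * pi) powr m\<close> split off here cancels against the
    powers of 2 and pi in \<open>chi\<close>.\<close>
  have p2: "(4 * pi\<^sup>2 * (m + t)) powr (m / 2) = 2 powr m * pi powr m * (m + t) powr (m / 2)"
  proof -
    have "4 * pi\<^sup>2 = (2 * pi) powr 2" by (simp add: power_mult_distrib)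
    then have "(4 * pi\<^sup>2) powr (m / 2) = (2 * pi) powr m" by (simp only: powr_powr) simp
    then show ?thesis using m t4 by (simp only: powr_mult)
  qed
  have 1: "1 - s = Complex (1 + m) (-t)" by (simp add: s_def complex_eq_iff)
  have "chi s = of_real pi powr (s - 1 / 2) * (Gamma ((1 - s) / 2) / Gamma (s / 2))"
    by (simp add: chi_def)
  also have "cmod \<dots> = pi powr (-m - 1 / 2) * (2 powr (-m) * cmod (Gamma (1 - s)) *
      cmod (sin (of_real pi * s / 2)) / sqrt pi)"
    using t4 by (subst Gamma_half_ratio)
      (simp_all add: s_def norm_mult norm_divide norm_powr_real_powr)
  also have "\<dots> = pi powr (-m - 1) * 2 powr (-m) * cmod (Gamma (1 - s)) *
      cmod (sin (of_real pi * s / 2))"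
    by (simp add: powr_diff powr_half_sqrt)
  finally have chi: "cmod (chi s) = pi powr (-m - 1) * 2 powr (-m) * cmod (Gamma (1 - s)) *
      cmod (sin (of_real pi * s / 2))" .
  have "sqrt t * (m + t) powr (m / 2) / pi \<le>
      (cmod (sin (of_real pi * (s / 2))) * cmod (Gamma (Complex 1 (-t)))) *
        (m + t) powr (m / 2) / pi"
    using t4 by (intro divide_right_mono mult_right_mono cmod_sin_mult_Gamma_ge)
      (auto simp: s_def)
  also have "\<dots> = pi powr (-m - 1) * 2 powr (-m) *
        (cmod (Gamma (Complex 1 (-t))) * (4 * pi\<^sup>2 * (m + t)) powr (m / 2)) *
        cmod (sin (of_real pi * s / 2))"
    unfolding p2 by (simp add: powr_diff powr_minus field_simps)
  also have "\<dots> \<le> cmod (chi s)"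
    unfolding chi 1 using m t t4 by (intro mult_left_mono mult_right_mono cmod_Gamma_ge) auto
  finally show ?thesis by (simp add: s_def)
qed

section \<open>Integrals over horizontal lines\<close>

lemma integrable_gaussian: "integrable lborel (\<lambda>x::real. exp (- x\<^sup>2))"
  and integral_gaussian: "(LINT x|lborel. exp (- x\<^sup>2)) = sqrt pi"
proof -
  have "has_bochner_integral lborel (\<lambda>x::real. exp (- x\<^sup>2)) (2 * (sqrt pi / 2))"
    using has_bochner_integral_even_function[OF gaussian_moment_0] by simp
  then show "integrable lborel (\<lambda>x::real. exp (- x\<^sup>2))"
    and "(LINT x|lborel. exp (- x\<^sup>2)) = sqrt pi"
    by (simp_all add: has_bochner_integral_iff)
qed

lemma has_contour_integral_linepath_horizontal:
  fixes f :: "complex \<Rightarrow> complex"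
  assumes "p < q"
  shows "(f has_contour_integral I) (linepath (Complex p b) (Complex q b)) \<longleftrightarrow>
           ((\<lambda>x. f (Complex x b)) has_integral I) {p..q}"
proof -
  have "linepath (Complex p b) (Complex q b) =
      (+) (Complex 0 b) \<circ> linepath (complex_of_real p) (complex_of_real q)"
    by (auto simp: fun_eq_iff linepath_def complex_eq_iff algebra_simps)
  moreover have "complex_of_real x + Complex 0 b = Complex x b" for x
    by (simp add: complex_eq_iff)
  ultimately show ?thesis using assms
    by (simp add: has_contour_integral_translate has_contour_integral_linepath_Reals_iff)
qed

text \<open>The dominating function is a constant on the compact middle part plus a Gaussian for the
  tails.\<close>

lemma integrable_horizontal_line:
  fixes f :: "complex \<Rightarrow> complex"
  assumes cont: "continuous_on {z. Im z = b} f"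
    and decay: "\<And>z. Im z = b \<Longrightarrow> \<bar>Re z\<bar> \<ge> T \<Longrightarrow> cmod (f z) \<le> C * exp (- (Re z)\<^sup>2)"
  shows "integrable lborel (\<lambda>x. f (Complex x b))"
proof -
  have cont': "continuous_on UNIV (\<lambda>x. f (Complex x b))"
    by (rule continuous_on_compose2[OF cont]) (auto intro!: continuous_intros simp: Complex_eq)
  have "compact ((\<lambda>x. f (Complex x b)) ` {-T..T})"
    by (intro compact_continuous_image continuous_on_subset[OF cont']) auto
  then obtain M where M: "\<And>x. \<bar>x\<bar> \<le> T \<Longrightarrow> cmod (f (Complex x b)) \<le> M"
    by (force dest!: compact_imp_bounded simp: bounded_iff)
  show ?thesis
  proof (rule Bochner_Integration.integrable_bound)
    show "integrable lborel (\<lambda>x. indicat_real {-T..T} x * \<bar>M\<bar> + \<bar>C\<bar> * exp (- x\<^sup>2))"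
      by (intro Bochner_Integration.integrable_add integrable_mult_left integrable_mult_right
          integrable_gaussian) (simp_all add: integrable_indicator_iff emeasure_lborel_Icc_eq)
    show "(\<lambda>x. f (Complex x b)) \<in> borel_measurable lborel"
      using borel_measurable_continuous_onI[OF cont'] by simp
    show "AE x in lborel. norm (f (Complex x b)) \<le>
        norm (indicat_real {-T..T} x * \<bar>M\<bar> + \<bar>C\<bar> * exp (- x\<^sup>2))"
    proof (rule AE_I2)
      fix x
      have *: "norm (indicat_real {-T..T} x * \<bar>M\<bar> + \<bar>C\<bar> * exp (- x\<^sup>2)) =
          indicat_real {-T..T} x * \<bar>M\<bar> + \<bar>C\<bar> * exp (- x\<^sup>2)"
        by simp
      show "norm (f (Complex x b)) \<le>
        norm (indicat_real {-T..T} x * \<bar>M\<bar> + \<bar>C\<bar> * exp (- x\<^sup>2))"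
      proof (cases "\<bar>x\<bar> \<le> T")
        case True
        then have "cmod (f (Complex x b)) \<le> \<bar>M\<bar>" using M[of x] by simp
        moreover have ind: "indicat_real {-T..T} x = 1" using True by (simp add: abs_le_iff)
        moreover have "0 \<le> \<bar>C\<bar> * exp (- x\<^sup>2)" by simp
        ultimately show ?thesis unfolding * unfolding ind mult_1 by linarith
      next
        case False
        then have "cmod (f (Complex x b)) \<le> C * exp (- x\<^sup>2)" using decay[of "Complex x b"] by simp
        also have "\<dots> \<le> \<bar>C\<bar> * exp (- x\<^sup>2)" by (intro mult_right_mono) auto
        finally show ?thesis unfolding * by (simp add: add_increasing)
      qed
    qed
  qed
qed

lemma tendsto_integral_symmetric_interval:
  fixes f :: "real \<Rightarrow> complex"
  assumes "integrable lborel f"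
  shows "((\<lambda>n. LINT x:{-real n..real n}|lborel. f x) \<longlongrightarrow> (LINT x|lborel. f x)) sequentially"
  unfolding set_lebesgue_integral_def
proof (rule integral_dominated_convergence)
  show "integrable lborel (\<lambda>x. norm (f x))" using assms by simp
  show "AE x in lborel. (\<lambda>n. indicator {-real n..real n} x *\<^sub>R f x) \<longlonglongrightarrow> f x"
  proof (rule AE_I2)
    fix x :: real
    have "eventually (\<lambda>n. real n \<ge> \<bar>x\<bar>) sequentially" by real_asymp
    then show "(\<lambda>n. indicator {-real n..real n} x *\<^sub>R f x) \<longlonglongrightarrow> f x"
      by (intro tendsto_eventually; eventually_elim) (auto simp: indicator_def)
  qed
qed (use assms in \<open>auto simp: indicator_def\<close>)

text \<open>Apply the residue theorem to the rectangles with \<open>\<bar>Re z\<bar> \<le> n\<close>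
  and let \<open>n\<close> grow; the Gaussian decay kills the vertical sides. Counterclockwise
  orientation runs the lower side from left to right, hence the order of the difference.\<close>

lemma integral_horizontal_lines_diff:
  fixes f :: "complex \<Rightarrow> complex"
  assumes S: "open S" "convex S" "{z. a \<le> Im z \<and> Im z \<le> b} \<subseteq> S"
    and ab: "a < b"
    and P: "finite P" "P \<subseteq> {z. a < Im z \<and> Im z < b}"
    and holo: "f holomorphic_on S - P"
    and decay: "\<And>z. a \<le> Im z \<Longrightarrow> Im z \<le> b \<Longrightarrow> \<bar>Re z\<bar> \<ge> T \<Longrightarrow> cmod (f z) \<le> C * exp (- (Re z)\<^sup>2)"
  shows "(LINT x|lborel. f (Complex x a)) - (LINT x|lborel. f (Complex x b)) =
           2 * of_real pi * \<i> * (\<Sum>p\<in>P. residue f p)"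
proof -
  have cont: "continuous_on (S - P) f" by (rule holomorphic_on_imp_continuous_on[OF holo])
  have int: "integrable lborel (\<lambda>x. f (Complex x y))" if "y = a \<or> y = b" for y
  proof (rule integrable_horizontal_line)
    show "continuous_on {z. Im z = y} f"
      by (rule continuous_on_subset[OF cont]) (use S(3) P(2) ab that in auto)
    show "cmod (f z) \<le> C * exp (- (Re z)\<^sup>2)" if "Im z = y" "T \<le> \<bar>Re z\<bar>" for z
      using decay[of z] \<open>y = a \<or> y = b\<close> that ab by auto
  qed
  obtain R where R: "\<And>p. p \<in> P \<Longrightarrow> \<bar>Re p\<bar> < R"
  proof -
    have "bounded (Re ` P)" using P(1) by (intro finite_imp_bounded) auto
    then obtain R where "\<And>p. p \<in> P \<Longrightarrow> \<bar>Re p\<bar> \<le> R" by (auto simp: bounded_iff)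
    then show ?thesis by (intro that[of "R + 1"]) force
  qed
  define J where "J y n = (LINT x:{-real n..real n}|lborel. f (Complex x y))" for y n
  \<comment> \<open>By the residue theorem \<open>D n\<close> is minus the contribution of the two
    vertical sides once all of \<open>P\<close> lies inside the rectangle.\<close>
  define D where "D n = J a n - J b n - 2 * of_real pi * \<i> * (\<Sum>p\<in>P. residue f p)" for n
  have D_le: "cmod (D n) \<le> 2 * (C * exp (- (real n)\<^sup>2) * (b - a))"
    if n: "real n \<ge> T" "real n \<ge> R" "n > 0" for n
  proof -
    define l1 l2 l3 l4 where "l1 = linepath (Complex (-n) a) (Complex n a)"
      and "l2 = linepath (Complex n a) (Complex n b)"
      and "l3 = linepath (Complex n b) (Complex (-n) b)"
      and "l4 = linepath (Complex (-n) b) (Complex (-n) a)"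
    define g where "g = rectpath (Complex (-n) a) (Complex n b)"
    have g: "g = l1 +++ l2 +++ l3 +++ l4"
      by (simp add: g_def rectpath_def Let_def l1_def l2_def l3_def l4_def)
    have img: "path_image g = {z. \<bar>Re z\<bar> \<le> n \<and> a \<le> Im z \<and> Im z \<le> b} -
        {z. \<bar>Re z\<bar> < n \<and> a < Im z \<and> Im z < b}"
      unfolding g_def using n ab
      by (subst path_image_rectpath_cbox_minus_box) (auto simp: in_cbox_complex_iff in_box_complex_iff)
    have img_sub: "path_image g \<subseteq> S - P"
      unfolding img using S(3) P(2) R n by fastforce
    have wind: "winding_number g p = 1" if "p \<in> P" for p
      unfolding g_def by (rule winding_number_rectpath)
        (use R[OF that] P(2) n that in \<open>auto simp: in_box_complex_iff\<close>)
    have "contour_integral g f = 2 * pi * \<i> * (\<Sum>p\<in>P. winding_number g p * residue f p)"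
    proof (rule Residue_theorem[OF S(1) convex_connected[OF S(2)] P(1) holo])
      show "\<forall>z. z \<notin> S \<longrightarrow> winding_number g z = 0"
        unfolding g_def using S(3) n ab
        by (auto intro!: winding_number_rectpath_outside simp: in_cbox_complex_iff)
    qed (use img_sub in \<open>simp_all add: g_def\<close>)
    then have res: "contour_integral g f = 2 * of_real pi * \<i> * (\<Sum>p\<in>P. residue f p)"
      by (simp add: wind)
    have pim: "path_image g = path_image l1 \<union> path_image l2 \<union> path_image l3 \<union> path_image l4"
      unfolding g l1_def l2_def l3_def l4_def by (simp add: path_image_join Un_assoc)
    have ci: "f contour_integrable_on l" if "l \<in> {l1, l2, l3, l4}" for l
    proof -
      have "continuous_on (path_image l) f"
        by (rule continuous_on_subset[OF cont]) (use img_sub pim that in auto)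
      then show ?thesis using that
        by (auto simp: l1_def l2_def l3_def l4_def intro!: contour_integrable_continuous_linepath)
    qed
    have split: "contour_integral g f = contour_integral l1 f + contour_integral l2 f +
        contour_integral l3 f + contour_integral l4 f"
      unfolding g using ci by (simp add: l1_def l2_def l3_def l4_def)
    have horiz: "contour_integral (linepath (Complex (-n) y) (Complex n y)) f = J y n"
      if "y = a \<or> y = b" for y
    proof -
      have "set_integrable lborel {-real n..real n} (\<lambda>x. f (Complex x y))"
        using int[OF that] unfolding set_integrable_def
        by (intro integrable_mult_indicator) auto
      from set_borel_integral_eq_integral[OF this]
      have "((\<lambda>x. f (Complex x y)) has_integral J y n) {-real n..real n}"
        by (simp add: J_def has_integral_integral)
      then show ?thesis
        using has_contour_integral_linepath_horizontal[of "-real n" "real n" f "J y n" y] n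
        by (intro contour_integral_unique) simp
    qed
    have vert: "cmod (contour_integral (linepath (Complex x y) (Complex x y')) f) \<le>
        C * exp (- (real n)\<^sup>2) * (b - a)"
      if x: "\<bar>x\<bar> = real n" and y: "(y = a \<and> y' = b) \<or> (y = b \<and> y' = a)"
        and f: "f contour_integrable_on linepath (Complex x y) (Complex x y')" for x y y'
    proof -
      have bound: "cmod (f z) \<le> C * exp (- (real n)\<^sup>2)"
        if z: "z \<in> closed_segment (Complex x y) (Complex x y')" for z
      proof -
        have "Re z = x" "Im z \<in> closed_segment y y'"
          using z by (simp_all add: closed_segment_same_Re)
        then show ?thesis
          using decay[of z] x y n ab
          by (auto simp: closed_segment_eq_real_ivl simp flip: power2_abs[of x] split: if_splits)
      qed
      \<comment> \<open>No sign of \<open>C\<close> is assumed; nonnegativity comes from the bound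
        on a norm at an endpoint.\<close>
      have "0 \<le> C * exp (- (real n)\<^sup>2)"
        using norm_ge_zero bound[of "Complex x y"] by (rule order_trans) simp
      moreover have "cmod (Complex x y' - Complex x y) = b - a"
        using y ab by (auto simp: cmod_def)
      ultimately show ?thesis
        using contour_integral_bound_linepath[OF f _ bound] by simp
    qed
    have "contour_integral l3 f = - J b n"
    proof -
      have "continuous_on (closed_segment (Complex n b) (Complex (-n) b)) f"
        by (rule continuous_on_subset[OF cont]) (use img_sub pim in \<open>auto simp: l3_def\<close>)
      then show ?thesis
        unfolding l3_def using horiz[of b]
        by (simp add: contour_integral_reverse_linepath[of "Complex n b"])
    qed
    then have "D n = - (contour_integral l2 f + contour_integral l4 f)"
      using split res horiz[of a] by (simp add: D_def l1_def algebra_simps)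
    then have "cmod (D n) = cmod (contour_integral l2 f + contour_integral l4 f)"
      by (simp only: norm_minus_cancel)
    also have "\<dots> \<le> cmod (contour_integral l2 f) + cmod (contour_integral l4 f)"
      by (rule norm_triangle_ineq)
    also have "\<dots> \<le> C * exp (- (real n)\<^sup>2) * (b - a) + C * exp (- (real n)\<^sup>2) * (b - a)"
      using ci[of l2] ci[of l4] unfolding l2_def l4_def by (intro add_mono vert) auto
    finally show ?thesis by (simp only: mult_2)
  qed
  have "D \<longlonglongrightarrow> 0"
  proof (rule Lim_null_comparison)
    show "eventually (\<lambda>n. cmod (D n) \<le> 2 * (C * exp (- (real n)\<^sup>2) * (b - a))) sequentially"
    proof -
      have "eventually (\<lambda>n. real n \<ge> T \<and> real n \<ge> R \<and> n > 0) sequentially"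
        by (intro eventually_conj eventually_gt_at_top) real_asymp+
      then show ?thesis by eventually_elim (use D_le in blast)
    qed
    show "(\<lambda>n. 2 * (C * exp (- (real n)\<^sup>2) * (b - a))) \<longlonglongrightarrow> 0" by real_asymp
  qed
  moreover have "D \<longlonglongrightarrow> (LINT x|lborel. f (Complex x a)) - (LINT x|lborel. f (Complex x b)) -
           2 * of_real pi * \<i> * (\<Sum>p\<in>P. residue f p)"
    unfolding D_def J_def by (intro tendsto_intros tendsto_integral_symmetric_interval int) auto
  ultimately show ?thesis
    using LIMSEQ_unique by fastforce
qed

section \<open>The integrand in rotated coordinates\<close>

text \<open>Substituting \<open>x = cis (\<pi>/4) z\<close> makes the lines of integration horizontal: crossing point \<open>c\<close> corresponds
  to \<open>Im z = -c / sqrt 2\<close>, so that rectangles can be used as contours.\<close>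

definition rot_integrand :: "complex \<Rightarrow> complex \<Rightarrow> complex" where
  "rot_integrand s z = aux_integrand s (cis (pi / 4) * z) * cis (pi / 4)"

lemma cis_pi_4: "cis (pi / 4) = Complex (1 / sqrt 2) (1 / sqrt 2)"
  by (simp add: complex_eq_iff cos_45 sin_45 real_div_sqrt field_simps)

lemma Re_rot: "Re (cis (pi / 4) * z) = (Re z - Im z) / sqrt 2"
  and Im_rot: "Im (cis (pi / 4) * z) = (Re z + Im z) / sqrt 2"
  by (simp_all add: cis_pi_4 field_simps)

text \<open>The minus sign reverses the direction: the given path runs from upper right to lower
  left, whereas increasing \<open>Re z\<close> moves the rotated point to the upper right.\<close>

lemma riemann_aux_eq:
  "riemann_aux c s = - (LINT x|lborel. rot_integrand s (Complex x (- c / sqrt 2)))"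
proof -
  have cis: "cis (- (3 * pi / 4)) = - cis (pi / 4)"
  proof -
    have "cis (- (3 * pi / 4)) = cis (pi / 4 - pi)" by simp
    then show ?thesis by (simp only: cis_divide [symmetric]) simp
  qed
  have pt: "complex_of_real c + complex_of_real u * cis (- (3 * pi / 4)) =
      cis (pi / 4) * Complex (c / sqrt 2 - u) (- c / sqrt 2)" for u
    unfolding cis by (simp add: cis_pi_4 complex_eq_iff field_simps)
  have "riemann_aux c s =
      (LINT u|lborel. - rot_integrand s (Complex (c / sqrt 2 - u) (- c / sqrt 2)))"
    unfolding riemann_aux_def pt by (simp add: cis rot_integrand_def)
  also have "\<dots> = (LINT u|lborel. - rot_integrand s (Complex u (- c / sqrt 2)))"
    using lborel_integral_real_affine[of "-1" "\<lambda>u. - rot_integrand s (Complex u (- c / sqrt 2))" "c / sqrt 2"]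
    by simp
  finally show ?thesis by simp
qed

text \<open>The rotation turns \<open>pi * i * x^2\<close> into \<open>- pi * z^2\<close>, which
  shows the Gaussian decay along horizontal lines.\<close>

lemma cmod_rot_integrand:
  assumes "z \<noteq> 0"
  shows "cmod (rot_integrand s z) =
    exp (- Re s * ln (cmod z) + Im s * Im (Ln (cis (pi / 4) * z)) - pi * ((Re z)\<^sup>2 - (Im z)\<^sup>2)) /
      (2 * cmod (sin (of_real pi * (cis (pi / 4) * z))))"
proof -
  define x where "x = cis (pi / 4) * z"
  have x: "cmod x = cmod z" "x \<noteq> 0" using assms by (simp_all add: x_def norm_mult)
  have "x\<^sup>2 = \<i> * z\<^sup>2"
    by (simp add: x_def power_mult_distrib Complex.DeMoivre)
  then have 1: "Re (of_real pi * \<i> * x\<^sup>2) = - pi * ((Re z)\<^sup>2 - (Im z)\<^sup>2)"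
    by (simp add: power2_eq_square)
  have 2: "Re (- s * Ln x) = - Re s * ln (cmod z) + Im s * Im (Ln x)"
    using x by simp
  have 3: "exp (of_real pi * \<i> * x) - exp (- (of_real pi * \<i> * x)) = 2 * \<i> * sin (of_real pi * x)"
    by (simp add: sin_exp_eq mult_ac)
  show ?thesis
    unfolding rot_integrand_def aux_integrand_def x_def [symmetric] 3
    unfolding norm_mult norm_divide norm_exp_eq_Re 1 2 by (simp flip: exp_add)
qed

text \<open>Far out in the strip the rotated point has imaginary part at least 1 in modulus, so the
  sine stays away from 0. The Gaussian of rate pi then outweighs the growth of
  \<open>m * ln (cmod z)\<close>.\<close>

lemma rot_integrand_decay:
  assumes s: "Re s \<le> 0" "Im s \<ge> 0" and B: "B \<ge> 0"
    and z: "- B \<le> Im z" "Im z < 0" "\<bar>Re z\<bar> \<ge> B + 2"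
  shows "cmod (rot_integrand s z) \<le>
    exp ((Re s)\<^sup>2 - Re s * B + Im s * pi + pi * B\<^sup>2) * exp (- (Re z)\<^sup>2)"
proof -
  define m where "m = - Re s"
  have z0: "z \<noteq> 0" using z by auto
  have "1 * sqrt 2 \<le> \<bar>Re z + Im z\<bar>"
    using z sqrt2_less_2 by linarith
  then have y: "\<bar>Im (cis (pi / 4) * z)\<bar> \<ge> 1"
    unfolding Im_rot by (simp add: abs_divide field_simps)
  have "1 \<le> \<bar>pi * Im (cis (pi / 4) * z)\<bar>"
    using mult_mono[of 1 pi 1 "\<bar>Im (cis (pi / 4) * z)\<bar>"] y pi_ge_two by (simp add: abs_mult)
  also have "\<dots> \<le> \<bar>sinh (pi * Im (cis (pi / 4) * z))\<bar>"
    using real_le_abs_sinh by (simp add: sinh_field_def exp_minus)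
  also have "\<dots> \<le> cmod (sin (of_real pi * (cis (pi / 4) * z)))"
    using cmod_sin_ge[of "of_real pi * (cis (pi / 4) * z)"] by simp
  finally have "1 \<le> 2 * cmod (sin (of_real pi * (cis (pi / 4) * z)))" by simp
  then have "cmod (rot_integrand s z) \<le> exp (- Re s * ln (cmod z) +
      Im s * Im (Ln (cis (pi / 4) * z)) - pi * ((Re z)\<^sup>2 - (Im z)\<^sup>2)) / 1"
    unfolding cmod_rot_integrand[OF z0] by (intro divide_left_mono) auto
  also have "\<dots> \<le> exp (m\<^sup>2 + m * B + Im s * pi + pi * B\<^sup>2 - (Re z)\<^sup>2)"
  proof -
    have "ln (cmod z) \<le> cmod z" using z0 ln_le_minus_one[of "cmod z"] by simp
    also have "\<dots> \<le> \<bar>Re z\<bar> + \<bar>Im z\<bar>" by (rule cmod_le)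
    also have "\<dots> \<le> \<bar>Re z\<bar> + B" using z by simp
    finally have "ln (cmod z) \<le> \<bar>Re z\<bar> + B" .
    from mult_left_mono[OF this, of m] have "m * ln (cmod z) \<le> m * \<bar>Re z\<bar> + m * B"
      using s by (simp add: m_def algebra_simps)
    \<comment> \<open>The linear term costs half of \<open>(Re z)\<^sup>2\<close>; since
      \<open>pi \<ge> 2\<close>, a full \<open>(Re z)\<^sup>2\<close> is still left for the
      decay.\<close>
    moreover have "2 * (m * \<bar>Re z\<bar>) \<le> m\<^sup>2 + (Re z)\<^sup>2"
      using sum_squares_bound[of m "\<bar>Re z\<bar>"] by simp
    moreover have "Im s * Im (Ln (cis (pi / 4) * z)) \<le> Im s * pi"
      using s z0 by (intro mult_left_mono Im_Ln_le_pi) auto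
    moreover have "pi * (Im z)\<^sup>2 \<le> pi * B\<^sup>2"
      using z B by (intro mult_left_mono) (auto simp: abs_le_square_iff [symmetric])
    moreover have "2 * (Re z)\<^sup>2 \<le> pi * (Re z)\<^sup>2"
      using pi_ge_two by (intro mult_right_mono) auto
    ultimately have "m * ln (cmod z) + Im s * Im (Ln (cis (pi / 4) * z)) -
        (pi * (Re z)\<^sup>2 - pi * (Im z)\<^sup>2) \<le> m\<^sup>2 + m * B + Im s * pi + pi * B\<^sup>2 - (Re z)\<^sup>2"
      using zero_le_power2[of m] zero_le_power2[of "Re z"] by linarith
    then show ?thesis unfolding div_by_1 exp_le_cancel_iff right_diff_distrib m_def .
  qed
  also have "m\<^sup>2 + m * B + Im s * pi + pi * B\<^sup>2 - (Re z)\<^sup>2 =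
      ((Re s)\<^sup>2 - Re s * B + Im s * pi + pi * B\<^sup>2) + (- (Re z)\<^sup>2)"
    by (simp add: m_def)
  finally show ?thesis unfolding exp_add [symmetric] .
qed

section \<open>Poles of the rotated integrand and the shift of the line of integration\<close>

lemma residue_simple_pole_quotient:
  assumes "open S" "z \<in> S" "f holomorphic_on S" "g holomorphic_on S"
    and "g z = 0" "(g has_field_derivative D) (at z)" "D \<noteq> 0"
    and "\<And>w. w \<in> S - {z} \<Longrightarrow> g w \<noteq> 0"
  shows "residue (\<lambda>w. f w / g w) z = f z / D"
proof (rule residue_simple'[OF assms(1,2)])
  show "(\<lambda>w. f w / g w) holomorphic_on S - {z}"
    using assms by (intro holomorphic_on_divide holomorphic_on_subset[OF assms(3)]
      holomorphic_on_subset[OF assms(4)]) auto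
  have "isCont f z"
    using assms holomorphic_on_imp_continuous_on continuous_on_eq_continuous_at by blast
  moreover have "((\<lambda>w. (g w - g z) / (w - z)) \<longlongrightarrow> D) (at z)"
    using assms(6) by (simp add: has_field_derivative_iff)
  ultimately have "((\<lambda>w. f w / ((g w - g z) / (w - z))) \<longlongrightarrow> f z / D) (at z)"
    using assms(7) by (intro tendsto_divide) (auto simp: isCont_def)
  then show "((\<lambda>w. f w / g w * (w - z)) \<longlongrightarrow> f z / D) (at z)"
    using assms(5) by simp
qed

definition rot_pole :: "nat \<Rightarrow> complex" where
  "rot_pole n = of_nat n * cis (- (pi / 4))"

lemma rot_rot_pole [simp]: "cis (pi / 4) * rot_pole n = of_nat n"
  by (simp add: rot_pole_def cis_mult mult.left_commute)

lemma Im_rot_pole: "Im (rot_pole n) = - real n / sqrt 2"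
  by (simp add: rot_pole_def sin_45 real_div_sqrt field_simps)

text \<open>Splitting the integrand separates its singularities: the branch cut belongs to
  \<open>rot_num\<close>, the poles come from the zeros of \<open>rot_den\<close>.\<close>

definition rot_num :: "complex \<Rightarrow> complex \<Rightarrow> complex" where
  "rot_num s z = exp (- s * Ln (cis (pi / 4) * z)) *
     exp (of_real pi * \<i> * (cis (pi / 4) * z)\<^sup>2) * cis (pi / 4)"

definition rot_den :: "complex \<Rightarrow> complex" where
  "rot_den z = exp (of_real pi * \<i> * (cis (pi / 4) * z)) - exp (- (of_real pi * \<i> * (cis (pi / 4) * z)))"

lemma rot_integrand_eq: "rot_integrand s = (\<lambda>z. rot_num s z / rot_den z)"
  by (simp add: fun_eq_iff rot_integrand_def aux_integrand_def rot_num_def rot_den_def)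

lemma rot_den_eq: "rot_den z = 2 * \<i> * sin (of_real pi * (cis (pi / 4) * z))"
  by (simp add: sin_exp_eq rot_den_def mult_ac)

text \<open>After rotation the zeros are the integers, and the lower half-plane contains exactly the
  preimages of the positive ones.\<close>

lemma rot_den_eq_0D:
  assumes "rot_den z = 0" "Im z < 0"
  obtains n where "n \<ge> 1" "z = rot_pole n"
proof -
  obtain k :: int where "of_real pi * (cis (pi / 4) * z) = of_real (of_int k * pi)"
    using assms(1) unfolding rot_den_eq by (auto simp: sin_eq_0)
  then have k: "cis (pi / 4) * z = of_int k" by simp
  have "z = cis (- (pi / 4)) * cis (pi / 4) * z" by (simp add: cis_mult)
  also have "\<dots> = of_int k * cis (- (pi / 4))" unfolding mult.assoc k by (rule mult.commute)
  finally have z: "z = of_int k * cis (- (pi / 4))" .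
  then have "Im z = - real_of_int k / sqrt 2" by (simp add: sin_45 real_div_sqrt field_simps)
  with assms(2) have "k > 0" by (simp add: field_simps)
  then show ?thesis using z by (intro that[of "nat k"]) (auto simp: rot_pole_def)
qed

text \<open>The rotation maps the lower half-plane onto the half-plane where the real part exceeds
  the imaginary part, which misses the cut of the logarithm.\<close>

lemma rot_num_holomorphic: "rot_num s holomorphic_on {z. Im z < 0}"
proof -
  have "cis (pi / 4) * z \<notin> \<real>\<^sub>\<le>\<^sub>0" if "Im z < 0" for z
    using that unfolding complex_nonpos_Reals_iff Re_rot Im_rot
    by (auto simp: divide_le_0_iff)
  then show ?thesis unfolding rot_num_def
    by (intro holomorphic_intros) auto
qed

lemma rot_den_holomorphic: "rot_den holomorphic_on A"
  unfolding rot_den_def by (intro holomorphic_intros)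

text \<open>At the integer \<open>n\<close> the Gaussian factor has modulus 1 and the power has
  modulus \<open>n powr (- Re s)\<close>. The derivative of the denominator has modulus
  \<open>2 * pi\<close>, because its two exponentials coincide there.\<close>

lemma cmod_residue_rot_integrand:
  assumes "n \<ge> 1"
  shows "cmod (residue (rot_integrand s) (rot_pole n)) = real n powr (- Re s) / (2 * pi)"
proof -
  \<comment> \<open>The open strip between the two neighbouring poles, so that
    \<open>rot_pole n\<close> is the only zero of the denominator in it. For \<open>n = 1\<close>
    its upper edge is the real axis.\<close>
  define S where "S = {z. - (real n + 1) / sqrt 2 < Im z \<and> Im z < - (real n - 1) / sqrt 2}"
  have neg: "Im z < 0" if "z \<in> S" for z
  proof -
    have "- (real n - 1) / sqrt 2 \<le> 0" using assms by (intro divide_nonpos_pos) auto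
    then show ?thesis using that unfolding S_def by auto
  qed
  have openS: "open S"
    unfolding S_def by (intro open_Collect_conj open_Collect_less continuous_intros)
  define E where "E = exp (of_real pi * \<i> * of_nat n)"
  have "rot_den (rot_pole n) = 0"
    unfolding rot_den_eq rot_rot_pole
    using sin_of_real[of "real n * pi", where 'a = complex] by (simp add: mult.commute)
  then have E: "exp (- (of_real pi * \<i> * of_nat n)) = E"
    unfolding rot_den_def rot_rot_pole E_def by simp
  have "residue (\<lambda>z. rot_num s z / rot_den z) (rot_pole n) =
      rot_num s (rot_pole n) / (of_real pi * \<i> * cis (pi / 4) * E + of_real pi * \<i> * cis (pi / 4) * E)"
  proof (rule residue_simple_pole_quotient[OF openS])
    show "rot_pole n \<in> S"
      unfolding S_def Im_rot_pole mem_Collect_eq by (intro conjI divide_strict_right_mono) auto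
    show "rot_num s holomorphic_on S"
      by (rule holomorphic_on_subset[OF rot_num_holomorphic]) (use neg in auto)
    show "(rot_den has_field_derivative
        of_real pi * \<i> * cis (pi / 4) * E + of_real pi * \<i> * cis (pi / 4) * E) (at (rot_pole n))"
      unfolding rot_den_def
      by (rule derivative_eq_intros refl | simp only: rot_rot_pole E)+ (simp add: E_def mult_ac)
    show "rot_den w \<noteq> 0" if w: "w \<in> S - {rot_pole n}" for w
    proof
      assume "rot_den w = 0"
      then obtain k where k: "k \<ge> 1" "w = rot_pole k" using neg[of w] w rot_den_eq_0D[of w] by blast
      with w have "- (real n + 1) / sqrt 2 < - real k / sqrt 2" "- real k / sqrt 2 < - (real n - 1) / sqrt 2"
        by (simp_all only: S_def Im_rot_pole mem_Collect_eq Diff_iff)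
      then have "k = n" unfolding divide_less_cancel by simp
      then show False using k w by simp
    qed
  qed (use \<open>rot_den (rot_pole n) = 0\<close> in \<open>auto intro: rot_den_holomorphic simp: E_def\<close>)
  moreover have "cmod (rot_num s (rot_pole n)) = real n powr (- Re s)"
    using assms by (simp add: rot_num_def norm_mult powr_def Ln_of_nat power2_eq_square)
  moreover have "cmod (of_real pi * \<i> * cis (pi / 4) * E + of_real pi * \<i> * cis (pi / 4) * E) = 2 * pi"
    unfolding mult_2 [symmetric] by (simp add: norm_mult E_def)
  ultimately show ?thesis by (simp add: rot_integrand_eq norm_divide)
qed

lemma rot_integrand_holomorphic:
  "rot_integrand s holomorphic_on {z. Im z < 0 \<and> rot_den z \<noteq> 0}"
  unfolding rot_integrand_eq
  by (intro holomorphic_intros rot_den_holomorphic holomorphic_on_subset[OF rot_num_holomorphic]) auto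

text \<open>The poles crossed between the crossing points \<open>c\<close> and
  \<open>N + 1 / 2\<close> are exactly the integers from 1 to \<open>N\<close>.\<close>

lemma riemann_aux_shift:
  assumes s: "Re s \<le> 0" "Im s \<ge> 0" and c: "0 < c" "c < 1" and N: "N \<ge> 1"
  shows "riemann_aux c s = 2 * of_real pi * \<i> * (\<Sum>n=1..N. residue (rot_integrand s) (rot_pole n)) -
           (LINT x|lborel. rot_integrand s (Complex x (- (real N + 1 / 2) / sqrt 2)))"
proof -
  define P where "P = rot_pole ` {1..N}"
  \<comment> \<open>An open neighbourhood of the closed strip that stops before the next pole
    \<open>N + 1\<close> and below the branch point 0.\<close>
  define S where "S = {z. - (real N + 1) / sqrt 2 < Im z \<and> Im z < 0}"
  define a b where "a = - (real N + 1 / 2) / sqrt 2" and "b = - c / sqrt 2"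
  have "inj rot_pole"
  proof (rule injI)
    fix m n assume "rot_pole m = rot_pole n"
    then have "Im (rot_pole m) = Im (rot_pole n)" by simp
    then show "m = n" by (simp add: Im_rot_pole)
  qed
  then have inj: "inj_on rot_pole {1..N}" by (rule inj_on_subset) simp
  have holo: "rot_integrand s holomorphic_on S - P"
  proof (rule holomorphic_on_subset[OF rot_integrand_holomorphic])
    have False if z: "z \<in> S - P" "rot_den z = 0" for z
    proof -
      obtain n where n: "n \<ge> 1" "z = rot_pole n"
        using z rot_den_eq_0D[of z] unfolding S_def by blast
      with z have "- (real N + 1) / sqrt 2 < - real n / sqrt 2"
        by (simp only: S_def Im_rot_pole mem_Collect_eq Diff_iff)
      then have "n \<le> N" unfolding divide_less_cancel by simp
      then show False using z n by (auto simp: P_def)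
    qed
    then show "S - P \<subseteq> {z. Im z < 0 \<and> rot_den z \<noteq> 0}" by (auto simp: S_def)
  qed
  have aS: "- (real N + 1) / sqrt 2 < a" unfolding a_def by (intro divide_strict_right_mono) auto
  have b0: "b < 0" using c by (simp add: b_def)
  have "(LINT x|lborel. rot_integrand s (Complex x a)) - (LINT x|lborel. rot_integrand s (Complex x b)) =
      2 * of_real pi * \<i> * (\<Sum>p\<in>P. residue (rot_integrand s) p)"
  proof (rule integral_horizontal_lines_diff)
    show "open S"
      unfolding S_def by (intro open_Collect_conj open_Collect_less continuous_intros)
    have "S = {z. Im z > - (real N + 1) / sqrt 2} \<inter> {z. Im z < 0}" by (auto simp: S_def)
    then show "convex S"
      by (simp add: convex_Int convex_halfspace_Im_gt convex_halfspace_Im_lt)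
    show "{z. a \<le> Im z \<and> Im z \<le> b} \<subseteq> S"
      using aS b0 by (auto simp: S_def)
    show "a < b" using c N unfolding a_def b_def by (intro divide_strict_right_mono) auto
    show "P \<subseteq> {z. a < Im z \<and> Im z < b}"
    proof -
      have "a < Im (rot_pole n) \<and> Im (rot_pole n) < b" if "n \<in> {1..N}" for n
        using that c unfolding Im_rot_pole a_def b_def
        by (intro conjI divide_strict_right_mono) auto
      then show ?thesis unfolding P_def by blast
    qed
    show "cmod (rot_integrand s z) \<le>
        exp ((Re s)\<^sup>2 - Re s * (-a) + Im s * pi + pi * (-a)\<^sup>2) * exp (- (Re z)\<^sup>2)"
      if "a \<le> Im z" "Im z \<le> b" "\<bar>Re z\<bar> \<ge> -a + 2" for z
      using that b0 s by (intro rot_integrand_decay) (auto simp: a_def)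
  qed (use holo in \<open>auto simp: P_def\<close>)
  also have "(\<Sum>p\<in>P. residue (rot_integrand s) p) = (\<Sum>n=1..N. residue (rot_integrand s) (rot_pole n))"
    unfolding P_def using inj by (simp add: sum.reindex)
  finally show ?thesis
    unfolding riemann_aux_eq a_def b_def by (simp add: algebra_simps)
qed

section \<open>Size of the integrand on the shifted line\<close>

lemma arctan_le_chord:
  fixes y :: real
  shows "arctan y - pi / 4 \<le> (\<bar>y\<bar> - 1) / 2"
proof -
  \<comment> \<open>\<open>g\<close> compares \<open>arctan\<close> with the slope of its tangent at
    1, where the inequality is sharp. On \<open>y \<ge> 0\<close> it has its minimum at 1; negative
    \<open>y\<close> are reduced to \<open>\<bar>y\<bar>\<close>.\<close>
  define g where "g y = (y - 1) / 2 - arctan y" for y :: real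
  have der: "(g has_real_derivative 1 / 2 - 1 / (1 + y\<^sup>2)) (at y)" for y
    unfolding g_def by (auto intro!: derivative_eq_intros simp: inverse_eq_divide)
  have "g 1 \<le> g y" if "y \<ge> 0" for y
  proof (cases "y \<ge> 1")
    case True
    then show ?thesis
    proof (rule DERIV_nonneg_imp_nondecreasing)
      show "\<exists>d. (g has_real_derivative d) (at x) \<and> 0 \<le> d" if "1 \<le> x" "x \<le> y" for x
      proof (intro exI conjI)
        have "1 / (1 + x\<^sup>2) \<le> 1 / 2"
          using one_le_power[of x 2] that by (intro divide_left_mono) (auto simp: add_pos_nonneg)
        then show "0 \<le> 1 / 2 - 1 / (1 + x\<^sup>2)" by simp
      qed (rule der)
    qed
  next
    case False
    then have "y \<le> 1" by simp
    then show ?thesis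
    proof (rule DERIV_nonpos_imp_nonincreasing)
      show "\<exists>d. (g has_real_derivative d) (at x) \<and> d \<le> 0" if "y \<le> x" "x \<le> 1" for x
      proof (intro exI conjI)
        have "1 / 2 \<le> 1 / (1 + x\<^sup>2)"
          using power_le_one[of x 2] that \<open>y \<ge> 0\<close>
          by (intro divide_left_mono) (auto simp: add_pos_nonneg)
        then show "1 / 2 - 1 / (1 + x\<^sup>2) \<le> 0" by simp
      qed (rule der)
    qed
  qed
  from this[OF abs_ge_zero, of y] have "arctan \<bar>y\<bar> - pi / 4 \<le> (\<bar>y\<bar> - 1) / 2"
    unfolding g_def arctan_one by argo
  moreover have "arctan y \<le> arctan \<bar>y\<bar>" by (simp add: arctan_le_iff)
  ultimately show ?thesis by simp
qed

text \<open>Write the point in polar form with argument \<open>arctan (u / r) - pi / 2\<close> and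
  rotate. The new argument lies between \<open>- 3 * pi / 4\<close> and \<open>pi / 4\<close>, so it
  is the principal one.\<close>

lemma Im_Ln_rot:
  assumes "r > 0"
  shows "Im (Ln (cis (pi / 4) * Complex u (- r))) = arctan (u / r) - pi / 4"
proof -
  define y where "y = u / r"
  define w where "w = Complex (ln (cmod (Complex u (-r)))) (arctan y - pi / 4)"
  have n: "cmod (Complex u (-r)) = r * sqrt (1 + y\<^sup>2)"
  proof -
    have "u\<^sup>2 + r\<^sup>2 = r\<^sup>2 * (1 + y\<^sup>2)" using assms by (simp add: y_def field_simps)
    then show ?thesis using assms by (simp add: cmod_def real_sqrt_mult)
  qed
  have u: "u = r * y" using assms by (simp add: y_def)
  have pos: "r * sqrt (1 + y\<^sup>2) > 0" using assms by (simp add: add_pos_nonneg)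
  have "Complex u (-r) = of_real (r * sqrt (1 + y\<^sup>2)) * cis (arctan y - pi / 2)"
    using u add_pos_nonneg[of 1 "y\<^sup>2"] by (simp add: complex_eq_iff cos_diff sin_diff cos_arctan sin_arctan)
  then have "cis (pi / 4) * Complex u (-r) =
      of_real (r * sqrt (1 + y\<^sup>2)) * cis (arctan y - pi / 2 + pi / 4)"
    by (simp only: cis_mult [symmetric] mult_ac)
  also have "arctan y - pi / 2 + pi / 4 = arctan y - pi / 4" by simp
  also have "of_real (r * sqrt (1 + y\<^sup>2)) * cis (arctan y - pi / 4) = exp w"
    using pos by (simp add: w_def n exp_eq_polar del: of_real_mult)
  finally have "cis (pi / 4) * Complex u (-r) = exp w" .
  moreover have "Ln (exp w) = w"
    using arctan_bounded[of y] pi_gt_zero by (intro Ln_exp) (auto simp: w_def)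
  ultimately show ?thesis by (simp add: w_def y_def)
qed

text \<open>On a line crossing midway between integers the sine becomes, up to sign, the cosine of
  \<open>a + i * a\<close>. Its squared modulus is \<open>cos^2 a + sinh^2 a\<close>, and
  \<open>|sinh a| \<ge> |a| \<ge> |sin a|\<close>.\<close>

lemma cmod_sin_rot_ge_1:
  "1 \<le> cmod (sin (of_real pi * (cis (pi / 4) * Complex u (- ((real N + 1 / 2) / sqrt 2)))))"
proof -
  define R w where "R = (real N + 1 / 2) / sqrt 2" and "w = cis (pi / 4) * Complex u (- R)"
  define a where "a = pi * Im w"
  have "2 * R / sqrt 2 = real N + 1 / 2" by (simp add: R_def)
  then have "Re w = Im w + (real N + 1 / 2)"
    unfolding w_def Re_rot Im_rot by (simp add: add_divide_distrib diff_divide_distrib)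
  then have e: "of_real pi * w = (Complex a a + of_real (pi / 2)) + of_real (real N * pi)"
    by (simp add: complex_eq_iff a_def algebra_simps)
  have "cmod (sin ((Complex a a + of_real (pi / 2)) + of_real (real N * pi))) = cmod (cos (Complex a a))"
    unfolding sin_add sin_of_real cos_of_real sin_npi cos_npi by (simp add: norm_mult norm_power)
  moreover have "1 \<le> (cmod (cos (Complex a a)))\<^sup>2"
  proof -
    have "(sin a)\<^sup>2 \<le> a\<^sup>2" using abs_sin_x_le_abs_x[of a] by (simp add: abs_le_square_iff)
    also have "a\<^sup>2 \<le> ((exp a - inverse (exp a)) / 2)\<^sup>2"
      using real_le_abs_sinh[of a] by (simp only: abs_le_square_iff)
    finally have "(sin a)\<^sup>2 \<le> (exp a - inverse (exp a))\<^sup>2 / 4" by (simp add: power_divide)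
    then show ?thesis
      using sin_cos_squared_add[of a] unfolding norm_cos_squared complex.sel by linarith
  qed
  ultimately have "1 \<le> (cmod (sin (of_real pi * w)))\<^sup>2" unfolding e by simp
  then have "1 \<le> cmod (sin (of_real pi * w))" by (rule power2_le_imp_le[OF _ norm_ge_zero, of 1, unfolded one_power2])
  then show ?thesis unfolding w_def R_def .
qed

text \<open>At \<open>u = r\<close> the line meets the real axis in the original coordinate, near
  the saddle point. There the linear terms in \<open>p\<close> of the argument and of the Gaussian
  nearly cancel: by \<open>near\<close>, the mismatch is at most
  \<open>8 * \<bar>p\<bar> \<le> p\<^sup>2 + 16\<close>. The power costs another
  \<open>p\<^sup>2\<close>, and \<open>pi > 3\<close> leaves the decay
  \<open>exp (- p\<^sup>2)\<close>.\<close>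

lemma cmod_rot_integrand_le:
  fixes N :: nat and m t u :: real
  defines "r \<equiv> (real N + 1 / 2) / sqrt 2"
  assumes m: "m \<ge> 0" and t: "t > 0" and near: "\<bar>t - 4 * pi * r\<^sup>2\<bar> \<le> 16 * r" and r: "3 * r\<^sup>2 \<le> t"
  shows "cmod (rot_integrand (Complex (-m) t) (Complex u (-r))) \<le>
    (m + t) powr (m / 2) * exp 16 / 2 * (exp (- (u - r)\<^sup>2) + exp (- (u + r)\<^sup>2))"
proof -
  define p where "p = \<bar>u\<bar> - r"
  define A where "A = m + t"
  have r0: "r > 0" by (simp add: r_def add_nonneg_pos)
  have A: "A > 0" "m \<le> A" "t \<le> A" using m t by (auto simp: A_def)
  have z0: "Complex u (-r) \<noteq> 0" using r0 by (simp add: complex_eq_iff)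
  have u2: "u\<^sup>2 = (p + r)\<^sup>2" by (simp add: p_def)
  have arg: "t * (arctan (u / r) - pi / 4) \<le> 2 * pi * r * p + 8 * \<bar>p\<bar>"
  proof -
    have "t * (arctan (u / r) - pi / 4) \<le> t * ((\<bar>u / r\<bar> - 1) / 2)"
      using t by (intro mult_left_mono arctan_le_chord) auto
    also have "\<dots> = 2 * pi * r * p + (t - 4 * pi * r\<^sup>2) * p / (2 * r)"
      using r0 by (simp add: p_def field_simps power2_eq_square)
    finally have "t * (arctan (u / r) - pi / 4) \<le> 2 * pi * r * p + (t - 4 * pi * r\<^sup>2) * p / (2 * r)" .
    moreover have "(t - 4 * pi * r\<^sup>2) * p / (2 * r) \<le> 16 * r * \<bar>p\<bar> / (2 * r)"
    proof (intro divide_right_mono)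
      have "(t - 4 * pi * r\<^sup>2) * p \<le> \<bar>t - 4 * pi * r\<^sup>2\<bar> * \<bar>p\<bar>"
        by (metis abs_ge_self abs_mult)
      also have "\<dots> \<le> 16 * r * \<bar>p\<bar>" using near by (intro mult_right_mono) auto
      finally show "(t - 4 * pi * r\<^sup>2) * p \<le> 16 * r * \<bar>p\<bar>" .
    qed (use r0 in auto)
    moreover have "16 * r * \<bar>p\<bar> / (2 * r) = 8 * \<bar>p\<bar>" using r0 by simp
    ultimately show ?thesis by linarith
  qed
  \<comment> \<open>Uniformity in \<open>m\<close> arises here:
    \<open>u\<^sup>2 + r\<^sup>2 \<le> A + 2 * p\<^sup>2\<close>, so the excess of the logarithm is
    at most \<open>2 * p\<^sup>2 / A\<close>, and \<open>m \<le> A\<close> absorbs the factor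
    \<open>m / 2\<close>.\<close>
  have size: "m * ln (cmod (Complex u (-r))) \<le> m / 2 * ln A + p\<^sup>2"
  proof -
    define y where "y = u\<^sup>2 + r\<^sup>2"
    have y: "y > 0" using r0 by (simp add: y_def add_nonneg_pos)
    have "y \<le> 3 * r\<^sup>2 + 2 * p\<^sup>2"
      using zero_le_power2[of "p - r"] unfolding y_def u2 by (simp add: power2_eq_square algebra_simps)
    then have "y / A \<le> (A + 2 * p\<^sup>2) / A" using r A by (intro divide_right_mono) auto
    also have "\<dots> = 1 + 2 * p\<^sup>2 / A" using A by (simp add: add_divide_distrib)
    finally have "ln y \<le> ln A + 2 * p\<^sup>2 / A"
      using ln_le_minus_one[of "y / A"] y A by (simp add: ln_div)
    then have "m / 2 * ln y \<le> m / 2 * (ln A + 2 * p\<^sup>2 / A)" using m by (intro mult_left_mono) auto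
    also have "\<dots> = m / 2 * ln A + m / A * p\<^sup>2" by (simp add: distrib_left)
    finally have "m / 2 * ln y \<le> m / 2 * ln A + m / A * p\<^sup>2" .
    moreover have "m / A * p\<^sup>2 \<le> 1 * p\<^sup>2" using A m by (intro mult_right_mono) auto
    moreover have "m * ln (cmod (Complex u (-r))) = m / 2 * ln y"
      using y by (simp add: cmod_def y_def ln_sqrt)
    ultimately show ?thesis by linarith
  qed
  have "cmod (rot_integrand (Complex (-m) t) (Complex u (-r))) =
      exp (m * ln (cmod (Complex u (-r))) + t * (arctan (u / r) - pi / 4) - pi * (u\<^sup>2 - r\<^sup>2)) /
      (2 * cmod (sin (of_real pi * (cis (pi / 4) * Complex u (-r)))))"
    unfolding cmod_rot_integrand[OF z0] Im_Ln_rot[OF r0] by simp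
  also have "\<dots> \<le> exp (m * ln (cmod (Complex u (-r))) + t * (arctan (u / r) - pi / 4) - pi * (u\<^sup>2 - r\<^sup>2)) / 2"
    using cmod_sin_rot_ge_1[of u N] by (intro divide_left_mono) (auto simp: r_def)
  also have "\<dots> \<le> exp (m / 2 * ln A + 16 - p\<^sup>2) / 2"
  proof -
    have "pi * (u\<^sup>2 - r\<^sup>2) = pi * p\<^sup>2 + 2 * pi * r * p"
      unfolding u2 by (simp add: power2_eq_square algebra_simps)
    moreover have "3 * p\<^sup>2 \<le> pi * p\<^sup>2" using pi_gt3 by (intro mult_right_mono) auto
    moreover have "8 * \<bar>p\<bar> \<le> p\<^sup>2 + 16"
      using zero_le_power2[of "\<bar>p\<bar> - 4"] by (simp add: power2_eq_square algebra_simps)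
    ultimately have "m * ln (cmod (Complex u (-r))) + t * (arctan (u / r) - pi / 4) - pi * (u\<^sup>2 - r\<^sup>2)
        \<le> m / 2 * ln A + 16 - p\<^sup>2"
      using arg size by linarith
    then show ?thesis by simp
  qed
  also have "exp (m / 2 * ln A + 16 - p\<^sup>2) / 2 = A powr (m / 2) * exp 16 / 2 * exp (- p\<^sup>2)"
  proof -
    have "exp (m / 2 * ln A + 16 - p\<^sup>2) = A powr (m / 2) * exp 16 * exp (- p\<^sup>2)"
      using A by (simp add: powr_def flip: exp_add)
    then show ?thesis by simp
  qed
  also have "\<dots> \<le> A powr (m / 2) * exp 16 / 2 * (exp (- (u - r)\<^sup>2) + exp (- (u + r)\<^sup>2))"
  proof (rule mult_left_mono)
    \<comment> \<open>Two shifted Gaussians replace the one in \<open>\<bar>u\<bar> - r\<close>, so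
      that the integral can be evaluated exactly.\<close>
    have "p\<^sup>2 = (u - r)\<^sup>2 \<or> p\<^sup>2 = (u + r)\<^sup>2"
      by (cases "u \<ge> 0") (auto simp: p_def power2_eq_square algebra_simps)
    then show "exp (- p\<^sup>2) \<le> exp (- (u - r)\<^sup>2) + exp (- (u + r)\<^sup>2)" by auto
  qed simp
  finally show ?thesis unfolding A_def .
qed

lemma cmod_line_integral_le:
  fixes N :: nat and m t :: real
  defines "r \<equiv> (real N + 1 / 2) / sqrt 2"
  assumes m: "m \<ge> 0" and t: "t > 0" and near: "\<bar>t - 4 * pi * r\<^sup>2\<bar> \<le> 16 * r" and r: "3 * r\<^sup>2 \<le> t"
  shows "cmod (LINT u|lborel. rot_integrand (Complex (-m) t) (Complex u (-r))) \<le>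
    (m + t) powr (m / 2) * exp 16 * sqrt pi"
proof -
  define K where "K = (m + t) powr (m / 2) * exp 16 / 2"
  define g where "g u = K * (exp (- (u - r)\<^sup>2) + exp (- (u + r)\<^sup>2))" for u
  have shift: "has_bochner_integral lborel (\<lambda>u. exp (- (u + d)\<^sup>2)) (sqrt pi)" for d :: real
    using integrable_gaussian integral_gaussian
      lborel_has_bochner_integral_real_affine_iff[of 1 "\<lambda>x. exp (- x\<^sup>2)" "sqrt pi" d]
    by (simp add: has_bochner_integral_iff add.commute)
  have "has_bochner_integral lborel g (K * (sqrt pi + sqrt pi))"
    unfolding g_def using shift[of "-r"] shift[of r]
    by (intro has_bochner_integral_mult_right has_bochner_integral_add) simp_all
  then have g: "integrable lborel g" "integral\<^sup>L lborel g = K * (sqrt pi + sqrt pi)"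
    by (simp_all add: has_bochner_integral_iff)
  have bound: "cmod (rot_integrand (Complex (-m) t) (Complex u (-r))) \<le> g u" for u
    using cmod_rot_integrand_le[OF m t, of N u] near r unfolding g_def K_def r_def by simp
  have "cmod (LINT u|lborel. rot_integrand (Complex (-m) t) (Complex u (-r))) \<le> integral\<^sup>L lborel g"
  proof (rule Bochner_Integration.integral_norm_bound_integral[OF _ g(1) bound])
    have r0: "r > 0" by (simp add: r_def add_nonneg_pos)
    show "integrable lborel (\<lambda>u. rot_integrand (Complex (-m) t) (Complex u (-r)))"
    proof (rule integrable_horizontal_line)
      have "rot_den z \<noteq> 0" if "Im z = - r" for z
      proof -
        have "z = Complex (Re z) (- r)" using that by (simp add: complex_eq_iff)
        then show ?thesis
          using cmod_sin_rot_ge_1[of "Re z" N] unfolding rot_den_eq r_def by auto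
      qed
      then show "continuous_on {z. Im z = - r} (rot_integrand (Complex (-m) t))"
        using r0 by (intro holomorphic_on_imp_continuous_on
            holomorphic_on_subset[OF rot_integrand_holomorphic]) auto
    qed (rule rot_integrand_decay[where B = r]; use m t r0 in simp)
  qed
  then show ?thesis by (simp add: g K_def)
qed

section \<open>Upper bound for the auxiliary function and comparison with chi\<close>

lemma cmod_riemann_aux_le:
  assumes c: "0 < c" "c < 1" and m: "m \<ge> 0" and t: "t \<ge> 2 * pi"
  shows "cmod (riemann_aux c (Complex (-m) t)) \<le>
    (1 + exp 16 * sqrt pi) * (sqrt t * (m + t) powr (m / 2))"
proof -
  define s where "s = Complex (-m) t"
  \<comment> \<open>The saddle point for \<open>m = 0\<close>. The assumption
    \<open>t \<ge> 2 * pi\<close> gives \<open>\<tau> \<ge> 1\<close>, hence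
    \<open>N \<ge> 1\<close>, and the new crossing point \<open>\<rho>\<close> is within 1/2 of
    \<open>\<tau>\<close>.\<close>
  define \<tau> where "\<tau> = sqrt (t / (2 * pi))"
  define N where "N = nat \<lfloor>\<tau>\<rfloor>"
  define \<rho> where "\<rho> = real N + 1 / 2"
  define r where "r = \<rho> / sqrt 2"
  have t6: "t \<ge> 6" using t pi_gt3 by simp
  have t\<tau>: "t = 2 * pi * \<tau>\<^sup>2" using t6 by (simp add: \<tau>_def)
  have \<tau>1: "\<tau> \<ge> 1" using t by (simp add: \<tau>_def)
  then have N: "N \<ge> 1" "real N \<le> \<tau>" "\<tau> < real N + 1"
    unfolding N_def by linarith+
  then have \<rho>: "\<bar>\<tau> - \<rho>\<bar> \<le> 1 / 2" "\<rho> \<ge> 3 / 2" "\<tau> \<le> \<rho> + 1 / 2" "\<rho> \<le> \<tau> + 1 / 2" unfolding \<rho>_def abs_le_iff by linarith+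
  have r: "r > 0" "r\<^sup>2 = \<rho>\<^sup>2 / 2" "\<rho> = sqrt 2 * r"
    using \<rho> by (auto simp: r_def power_divide)
  have near: "\<bar>t - 4 * pi * r\<^sup>2\<bar> \<le> 16 * r"
  proof -
    have "t - 4 * pi * r\<^sup>2 = 2 * pi * ((\<tau> - \<rho>) * (\<tau> + \<rho>))"
      unfolding t\<tau> r by (simp add: algebra_simps power2_eq_square)
    then have "\<bar>t - 4 * pi * r\<^sup>2\<bar> = 2 * pi * (\<bar>\<tau> - \<rho>\<bar> * \<bar>\<tau> + \<rho>\<bar>)"
      by (simp add: abs_mult)
    \<comment> \<open>Here \<open>\<tau> + \<rho> \<le> 2 * \<rho> + 1 / 2 \<le> 5 / 2 *
      \<rho>\<close>.\<close>
    also have "\<dots> \<le> 2 * pi * (1 / 2 * (5 / 2 * \<rho>))"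
      using \<rho> \<tau>1 by (intro mult_left_mono mult_mono) auto
    also have "\<dots> = pi * (5 / 2 * \<rho>)" by simp
    also have "\<dots> \<le> 4 * (5 / 2 * \<rho>)"
      using \<rho> pi_less_4 by (intro mult_right_mono) auto
    also have "\<dots> = 10 * sqrt 2 * r" using r by simp
    also have "\<dots> \<le> 16 * r"
    proof -
      have "sqrt 2 \<le> 8 / 5" by (rule real_le_lsqrt) (simp_all add: power2_eq_square)
      then show ?thesis using r by (intro mult_right_mono) auto
    qed
    finally show ?thesis .
  qed
  have "3 * r\<^sup>2 \<le> t"
  proof -
    have "\<rho> \<le> 3 / 2 * \<tau>" using \<rho>(4) \<tau>1 by linarith
    then have "\<rho>\<^sup>2 \<le> (3 / 2 * \<tau>)\<^sup>2" using \<rho> by (intro power_mono) auto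
    also have "\<dots> = 9 / 4 * \<tau>\<^sup>2" by (simp add: power2_eq_square)
    finally have "3 * r\<^sup>2 \<le> 27 / 8 * \<tau>\<^sup>2" by (simp add: r)
    also have "\<dots> \<le> 2 * pi * \<tau>\<^sup>2" using pi_gt3 by (intro mult_right_mono) auto
    finally show ?thesis unfolding t\<tau> .
  qed
  then have line: "cmod (LINT u|lborel. rot_integrand s (Complex u (- r))) \<le>
      (m + t) powr (m / 2) * exp 16 * sqrt pi"
    using cmod_line_integral_le[OF m, of t N] near t6 unfolding s_def r_def \<rho>_def by simp
  have \<tau>t: "\<tau> \<le> sqrt t"
    unfolding \<tau>_def using t6 pi_gt3 by (intro real_sqrt_le_mono) (simp add: divide_le_eq)
  have "cmod (2 * of_real pi * \<i> * (\<Sum>n=1..N. residue (rot_integrand s) (rot_pole n))) =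
      2 * pi * cmod (\<Sum>n=1..N. residue (rot_integrand s) (rot_pole n))"
    by (simp add: norm_mult)
  also have "\<dots> \<le> 2 * pi * (\<Sum>n=1..N. real n powr m / (2 * pi))"
    by (intro mult_left_mono sum_norm_le) (auto simp: cmod_residue_rot_integrand s_def)
  also have "\<dots> = (\<Sum>n=1..N. real n powr m)" by (simp add: sum_divide_distrib [symmetric])
  \<comment> \<open>The trivial bound: since \<open>n \<le> N \<le> sqrt t\<close>, there are at
    most \<open>sqrt t\<close> terms, each at most \<open>t powr (m / 2)\<close>.\<close>
  also have "\<dots> \<le> (\<Sum>n=1..N. sqrt t powr m)"
    using m N \<tau>t by (intro sum_mono powr_mono2) auto
  also have "\<dots> = real N * t powr (m / 2)"
    using t6 by (simp add: powr_half_sqrt [symmetric] powr_powr)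
  also have "\<dots> \<le> sqrt t * (m + t) powr (m / 2)"
    using N \<tau>t m t6 by (intro mult_mono powr_mono2) auto
  finally have poles: "cmod (2 * of_real pi * \<i> * (\<Sum>n=1..N. residue (rot_integrand s) (rot_pole n)))
      \<le> sqrt t * (m + t) powr (m / 2)" .
  have "riemann_aux c s =
      2 * of_real pi * \<i> * (\<Sum>n=1..N. residue (rot_integrand s) (rot_pole n)) -
      (LINT u|lborel. rot_integrand s (Complex u (- r)))"
    unfolding r_def \<rho>_def minus_divide_left
    using c N m t6 by (intro riemann_aux_shift) (auto simp: s_def)
  also have "cmod \<dots> \<le> sqrt t * (m + t) powr (m / 2) + (m + t) powr (m / 2) * exp 16 * sqrt pi"
    by (rule order_trans[OF norm_triangle_ineq4 add_mono[OF poles line]])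
  also have "(m + t) powr (m / 2) * exp 16 * sqrt pi \<le>
      exp 16 * sqrt pi * (sqrt t * (m + t) powr (m / 2))"
    using t6 mult_right_mono[of 1 "sqrt t" "(m + t) powr (m / 2) * exp 16 * sqrt pi"]
    by (simp add: mult_ac)
  finally show ?thesis by (simp add: s_def algebra_simps)
qed

lemma riemann_aux_le_chi:
  assumes "0 < c" "c < 1" "Re s \<le> 0" "Im s \<ge> exp 12"
  shows "cmod (riemann_aux c s) \<le> (1 + exp 16 * sqrt pi) * pi * cmod (chi s)"
proof -
  define m t where "m = - Re s" and "t = Im s"
  have s: "s = Complex (-m) t" by (simp add: m_def t_def complex_eq_iff)
  have mt: "m \<ge> 0" "t \<ge> exp 12" using assms by (simp_all add: m_def t_def)
  have "t \<ge> 2 * pi" using mt(2) exp_ge_add_one_self[of 12] pi_less_4 by linarith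
  then have "cmod (riemann_aux c s) \<le> (1 + exp 16 * sqrt pi) * (sqrt t * (m + t) powr (m / 2))"
    unfolding s using assms mt by (intro cmod_riemann_aux_le) auto
  also have "\<dots> \<le> (1 + exp 16 * sqrt pi) * (pi * cmod (chi s))"
    using cmod_chi_ge[OF mt] unfolding s
    by (intro mult_left_mono) (simp_all add: field_simps add_nonneg_nonneg)
  finally show ?thesis by (simp only: mult.assoc)
qed

text \<open>In the region a bounded imaginary part forces a bounded real part, because
  \<open>- Re s < Im s powr \<alpha>\<close> with \<open>\<alpha> > 0\<close>. Hence
  \<open>s\<close> can tend to infinity only with \<open>Im s\<close>.\<close>

lemma eventually_Im_ge_aux_region:
  "eventually (\<lambda>s. Im s \<ge> T) (inf at_infinity (principal (aux_region \<alpha>)))"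
  if "\<alpha> > 0"
proof -
  have "Im s \<ge> T" if s: "s \<in> aux_region \<alpha>" "cmod s \<ge> \<bar>T\<bar> powr \<alpha> + \<bar>T\<bar> + 1" for s
  proof (rule ccontr)
    assume "\<not> T \<le> Im s"
    then have T: "Im s \<le> \<bar>T\<bar>" by simp
    have "cmod s \<le> \<bar>Re s\<bar> + \<bar>Im s\<bar>" by (rule cmod_le)
    also have "\<dots> \<le> Im s powr \<alpha> + Im s" using s(1) by (simp add: aux_region_def)
    also have "Im s powr \<alpha> \<le> \<bar>T\<bar> powr \<alpha>"
      using s(1) T \<open>\<alpha> > 0\<close> by (intro powr_mono2) (auto simp: aux_region_def)
    finally show False using s(2) T by simp
  qed
  then show ?thesis
    unfolding eventually_inf_principal eventually_at_infinity by blast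
qed

theorem corollary25:
  fixes \<alpha> c :: real
  assumes "\<alpha> > 0" and "0 < c" and "c < 1"
  shows "riemann_aux c \<in> O[inf at_infinity (principal (aux_region \<alpha>))](\<lambda>s.
           chi s * complex_of_real (ln \<bar>Im s\<bar>))"
proof (rule bigoI)
  define F where "F = inf at_infinity (principal (aux_region \<alpha>))"
  have "eventually (\<lambda>s. s \<in> aux_region \<alpha>) F"
    unfolding F_def by (simp add: eventually_inf_principal)
  moreover have "eventually (\<lambda>s. Im s \<ge> exp 12) F"
    unfolding F_def using assms(1) by (rule eventually_Im_ge_aux_region)
  ultimately show "eventually (\<lambda>s. norm (riemann_aux c s) \<le>
      (1 + exp 16 * sqrt pi) * pi * norm (chi s * complex_of_real (ln \<bar>Im s\<bar>))) F"
  proof eventually_elim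
    case (elim s)
    have pos: "Im s > 0" using elim(2) by (meson exp_gt_zero less_le_trans)
    \<comment> \<open>The logarithm exceeds 1, so inserting it only enlarges the bound by
      \<open>chi\<close>.\<close>
    have "ln \<bar>Im s\<bar> \<ge> 12" using elim(2) pos by (simp add: ln_ge_iff)
    then have "cmod (chi s) * 1 \<le> cmod (chi s) * \<bar>ln \<bar>Im s\<bar>\<bar>"
      by (intro mult_left_mono) auto
    then have "(1 + exp 16 * sqrt pi) * pi * cmod (chi s) \<le>
        (1 + exp 16 * sqrt pi) * pi * norm (chi s * complex_of_real (ln \<bar>Im s\<bar>))"
      by (intro mult_left_mono) (simp_all add: norm_mult add_nonneg_nonneg)
    moreover have "cmod (riemann_aux c s) \<le> (1 + exp 16 * sqrt pi) * pi * cmod (chi s)"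
      using elim assms by (intro riemann_aux_le_chi) (auto simp: aux_region_def)
    ultimately show ?case by linarith
  qed
qed

end
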